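(* Let $k\ge 2$ and $P=\{A^k+B^k\mid A,B\in M_2(\mathbb F_3)\}$. Let $C_5$ be the set of nonzero nilpotent matrices in $M_2(\mathbb F_3)$ (the conjugacy class of $\begin{pmatrix}0&1\\0&0\end{pmatrix}$), and let $C_9,C_{10},C_{12}$ be the conjugacy classes in $M_2(\mathbb F_3)$ of $\begin{pmatrix}2&1\\0&2\end{pmatrix}$, $\begin{pmatrix}0&2\\1&0\end{pmatrix}$, $\begin{pmatrix}0&1\\1&1\end{pmatrix}$ respectively. Then $P=M_2(\mathbb F_3)$ if $k\not\equiv 0,6,12,18\pmod{24}$; $P=M_2(\mathbb F_3)\setminus C_5$ if $k\equiv 6$ or $18\pmod{24}$; and $P=M_2(\mathbb F_3)\setminus(C_5\cup C_9\cup C_{10}\cup C_{12})$ if $k\equiv 0\pmod{12}$. *)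

theory Defs
  imports "Jordan_Normal_Form.Matrix" "HOL-Library.Cardinality"
begin

definition mat2 :: "'a \<Rightarrow> 'a \<Rightarrow> 'a \<Rightarrow> 'a \<Rightarrow> 'a mat" where
  "mat2 a b c d = mat_of_rows_list 2 [[a, b], [c, d]]"

definition conj_class :: "'a :: semiring_1 mat \<Rightarrow> 'a mat set" where
  "conj_class A = {B. similar_mat B A}"

definition nilpotent_mat :: "'a :: semiring_1 mat \<Rightarrow> bool" where
  "nilpotent_mat A \<longleftrightarrow> square_mat A \<and> (\<exists>n. A ^\<^sub>m n = 0\<^sub>m (dim_row A) (dim_col A))"

definition sums_of_two_powers :: "nat \<Rightarrow> nat \<Rightarrow> 'a :: semiring_1 mat set" where
  "sums_of_two_powers n k =
     {A ^\<^sub>m k + B ^\<^sub>m k | A B. A \<in> carrier_mat n n \<and> B \<in> carrier_mat n n}"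

end

theory Submission
  imports Defs "Jordan_Normal_Form.Determinant" "HOL-Number_Theory.Residues"
begin

text \<open>
  A non-scalar matrix of size two is similar to the companion matrix of its characteristic polynomial,
  and being a sum of two \<open>k\<close>-th powers is invariant under similarity, so only the trace and the
  determinant of a non-scalar matrix matter. Over the field with three elements, a matrix \<open>A\<close> is a
  \<open>k\<close>-th power if \<open>A\<^sup>2 = A\<close>; if \<open>A\<^sup>2 = - A\<close> and \<open>k\<close> is odd; if \<open>A\<^sup>3 = 1\<close> and 3 does not divide \<open>k\<close>;
  if \<open>A\<^sup>2 = - 1\<close> and 4 does not divide \<open>k\<close>, since then \<open>A = (A - 1)\<^sup>2\<close> is the square of an element of
  order 8. Sums of two such matrices realise all companion matrices that are not excluded. Conversely,
  by the Cayley-Hamilton theorem a sixth power is scalar, or an idempotent of trace 1, or has square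
  \<open>- 1\<close> and trace 0; for a twelfth power the last alternative disappears. Adding up traces and
  determinants excludes the remaining classes, except for a nilpotent sum \<open>X + Y\<close> with
  \<open>X\<^sup>2 = Y\<^sup>2 = - 1\<close>; in that case each off-diagonal entry of the sum has a square that is the negative
  of a square, so the sum is zero because \<open>- 1\<close> is not a square.
\<close>

section \<open>Powers of square matrices\<close>

lemma pow_mat_add:
  assumes "A \<in> carrier_mat n n"
  shows "A ^\<^sub>m (i + j) = A ^\<^sub>m i * A ^\<^sub>m j"
proof -
  interpret semiring "ring_mat TYPE('a) n ()" by (rule semiring_mat)
  show ?thesis
    using nat_pow_mult[of A i j] assms
    by (simp add: pow_mat_ring_pow[OF assms, of _ "()"] ring_mat_simps)
qed

lemma pow_mat_mult:
  assumes "A \<in> carrier_mat n n"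
  shows "A ^\<^sub>m (i * j) = (A ^\<^sub>m i) ^\<^sub>m j"
proof -
  interpret semiring "ring_mat TYPE('a) n ()" by (rule semiring_mat)
  have "A ^\<^sub>m i \<in> carrier_mat n n"
    using assms by simp
  then show ?thesis
    using nat_pow_pow[of A i j] assms
    by (simp add: pow_mat_ring_pow[where b = "()"] ring_mat_simps)
qed

lemma pow_mat_2:
  assumes "A \<in> carrier_mat n n"
  shows "A ^\<^sub>m 2 = A * A"
  using assms by (simp add: numeral_2_eq_2)

lemma pow_mat_periodic:
  assumes A: "A \<in> carrier_mat n n" and period: "A ^\<^sub>m (m + 1) = A"
  shows "A ^\<^sub>m (m * q + 1) = A"
proof (induction q)
  case 0
  show ?case using A by simp
next
  case (Suc q)
  have "A ^\<^sub>m (m * Suc q + 1) = A ^\<^sub>m m * A ^\<^sub>m (m * q + 1)"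
    by (simp only: pow_mat_add[OF A, symmetric]) (simp add: algebra_simps)
  also have "\<dots> = A ^\<^sub>m (m + 1)"
    by (simp only: Suc) simp
  finally show ?case using period by simp
qed

lemma det_pow_mat:
  fixes A :: "'a :: comm_ring_1 mat"
  assumes "A \<in> carrier_mat n n"
  shows "det (A ^\<^sub>m k) = det A ^ k"
proof (induction k)
  case (Suc k)
  then show ?case
    using assms by (simp add: det_mult[of _ n] mult.commute)
qed (use assms in simp)

definition mat_powers :: "nat \<Rightarrow> nat \<Rightarrow> 'a :: semiring_1 mat set" where
  "mat_powers n k = (\<lambda>A. A ^\<^sub>m k) ` carrier_mat n n"

lemma mat_powers_carrier: "X \<in> mat_powers n k \<Longrightarrow> X \<in> carrier_mat n n"
  by (auto simp: mat_powers_def)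

lemma mat_powers_mult: "mat_powers n (i * j) = (\<lambda>X. X ^\<^sub>m j) ` mat_powers n i"
  by (auto simp: mat_powers_def image_image pow_mat_mult intro!: image_cong)

lemma mat_powers_dvd_antimono:
  assumes "i dvd k"
  shows "mat_powers n k \<subseteq> mat_powers n i"
proof -
  obtain j where k: "k = j * i"
    using assms by (metis dvdE mult.commute)
  show ?thesis
    unfolding k mat_powers_mult by (auto simp: mat_powers_def)
qed

lemma mat_powers_coprime_period:
  assumes X: "X \<in> carrier_mat n n" and period: "X ^\<^sub>m (m + 1) = X"
    and "coprime k m" and "k > 0"
  shows "X \<in> mat_powers n k"
proof -
  obtain i q where "k * i = m * q + 1"
    using bezout_nat[of k m] \<open>k > 0\<close> \<open>coprime k m\<close> by (auto simp: coprime_iff_gcd_eq_1)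
  then have "i * k = m * q + 1"
    by (simp add: mult.commute)
  then have "(X ^\<^sub>m i) ^\<^sub>m k = X"
    using pow_mat_periodic[OF X period] by (simp flip: pow_mat_mult[OF X])
  then show ?thesis
    using X by (auto simp: mat_powers_def intro!: image_eqI[of _ _ "X ^\<^sub>m i"])
qed

lemma idempotent_mem_mat_powers:
  assumes "X \<in> carrier_mat n n" and "X * X = X" and "k > 0"
  shows "X \<in> mat_powers n k"
  using assms by (intro mat_powers_coprime_period[where m = 1]) (simp_all add: pow_mat_2)

lemma sums_of_two_powers_eq:
  "sums_of_two_powers n k = {X + Y | X Y. X \<in> mat_powers n k \<and> Y \<in> mat_powers n k}"
  by (auto simp: sums_of_two_powers_def mat_powers_def)

lemma sums_of_two_powersI:
  assumes "X \<in> mat_powers n k" and "Y \<in> mat_powers n k" and "A = X + Y"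
  shows "A \<in> sums_of_two_powers n k"
  using assms by (auto simp: sums_of_two_powers_eq)

lemma sums_of_two_powers_carrier: "sums_of_two_powers n k \<subseteq> carrier_mat n n"
  by (auto simp: sums_of_two_powers_def)

lemma sums_of_two_powers_dvd_antimono:
  "i dvd k \<Longrightarrow> sums_of_two_powers n k \<subseteq> sums_of_two_powers n i"
  using mat_powers_dvd_antimono[of i k n] by (auto simp: sums_of_two_powers_eq)

section \<open>Similarity, trace and scalar matrices\<close>

lemma similar_mat_carrier:
  assumes "similar_mat A B" and "B \<in> carrier_mat n n"
  shows "A \<in> carrier_mat n n"
  using similar_matD[OF assms(1)] assms(2) by auto

lemma similar_matI_intertwine:
  fixes A :: "'a :: field mat"
  assumes A: "A \<in> carrier_mat n n" and B: "B \<in> carrier_mat n n" and S: "S \<in> carrier_mat n n"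
    and "det S \<noteq> 0" and intertwine: "A * S = S * B"
  shows "similar_mat A B"
proof -
  obtain T where T: "T \<in> carrier_mat n n" and ST: "S * T = 1\<^sub>m n" "T * S = 1\<^sub>m n"
    using det_non_zero_imp_unit[OF S \<open>det S \<noteq> 0\<close>, of "()"]
    by (auto simp: Units_def ring_mat_simps)
  have "S * B * T = A * (S * T)"
    using assoc_mult_mat[OF A S T] by (simp add: intertwine)
  then have "A = S * B * T"
    using A ST by simp
  then show ?thesis
    using A B S T ST by (intro similar_matI[where n = n and P = S and Q = T]) auto
qed

lemma sums_of_two_powers_similar:
  assumes sim: "similar_mat B A" and A: "A \<in> sums_of_two_powers n k"
  shows "B \<in> sums_of_two_powers n k"
proof -
  obtain X Y where XY: "X \<in> carrier_mat n n" "Y \<in> carrier_mat n n"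
    and A_eq: "A = X ^\<^sub>m k + Y ^\<^sub>m k"
    using A by (auto simp: sums_of_two_powers_def)
  then have B: "B \<in> carrier_mat n n"
    by (intro similar_mat_carrier[OF sim]) auto
  obtain S T where wit: "similar_mat_wit B A S T"
    using sim by (auto simp: similar_mat_def)
  have S: "S \<in> carrier_mat n n" and T: "T \<in> carrier_mat n n"
    and ST: "S * T = 1\<^sub>m n" "T * S = 1\<^sub>m n" and B_eq: "B = S * A * T"
    using similar_mat_witD2[OF B wit] by simp_all
  have conj_pow: "S * Z ^\<^sub>m k * T = (S * Z * T) ^\<^sub>m k" if "Z \<in> carrier_mat n n" for Z
    using S T ST that
    by (intro similar_mat_wit_pow_id [symmetric] similar_mat_witI[where n = n]) auto
  have pow_carrier: "X ^\<^sub>m k \<in> carrier_mat n n" "Y ^\<^sub>m k \<in> carrier_mat n n"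
    using XY by auto
  have "B = S * X ^\<^sub>m k * T + S * Y ^\<^sub>m k * T"
    unfolding B_eq A_eq mult_add_distrib_mat[OF S pow_carrier]
    using S T pow_carrier by (intro add_mult_distrib_mat[where nr = n]) auto
  then have "B = (S * X * T) ^\<^sub>m k + (S * Y * T) ^\<^sub>m k"
    using conj_pow XY by simp
  moreover have "S * X * T \<in> carrier_mat n n" "S * Y * T \<in> carrier_mat n n"
    using S T XY by auto
  ultimately show ?thesis
    unfolding sums_of_two_powers_def by blast
qed

definition mat_trace :: "'a :: comm_monoid_add mat \<Rightarrow> 'a" where
  "mat_trace A = (\<Sum>i<dim_row A. A $$ (i, i))"

lemma mat_trace_add:
  assumes "A \<in> carrier_mat n n" and "B \<in> carrier_mat n n"
  shows "mat_trace (A + B) = mat_trace A + mat_trace B"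
  using assms by (simp add: mat_trace_def sum.distrib)

lemma mat_trace_mult_comm:
  fixes A B :: "'a :: comm_semiring_0 mat"
  assumes "A \<in> carrier_mat n m" and "B \<in> carrier_mat m n"
  shows "mat_trace (A * B) = mat_trace (B * A)"
proof -
  have "mat_trace (A * B) = (\<Sum>i<n. \<Sum>j<m. A $$ (i, j) * B $$ (j, i))"
    using assms by (simp add: mat_trace_def scalar_prod_def lessThan_atLeast0)
  also have "\<dots> = (\<Sum>j<m. \<Sum>i<n. B $$ (j, i) * A $$ (i, j))"
    by (subst sum.swap) (simp add: mult.commute)
  also have "\<dots> = mat_trace (B * A)"
    using assms by (simp add: mat_trace_def scalar_prod_def lessThan_atLeast0)
  finally show ?thesis .
qed

lemma mat_trace_similar:
  fixes A :: "'a :: comm_semiring_1 mat"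
  assumes "similar_mat A B"
  shows "mat_trace A = mat_trace B"
proof -
  obtain n S T where carrier: "B \<in> carrier_mat n n" "S \<in> carrier_mat n n" "T \<in> carrier_mat n n"
    and TS: "T * S = 1\<^sub>m n" and "A = S * B * T"
    using similar_matD[OF assms] by auto
  then have "mat_trace A = mat_trace (T * (S * B))"
    using mat_trace_mult_comm[of "S * B" n n T] by simp
  also have "T * (S * B) = B"
    using carrier TS by (simp flip: assoc_mult_mat[of T n n S n B n])
  finally show ?thesis .
qed

definition scalar_mat :: "'a :: semiring_1 mat \<Rightarrow> bool" where
  "scalar_mat A \<longleftrightarrow> (\<exists>a. A = a \<cdot>\<^sub>m 1\<^sub>m (dim_row A))"

lemma scalar_mat_similar:
  fixes A :: "'a :: comm_semiring_1 mat"
  assumes "similar_mat A B" and "scalar_mat B"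
  shows "scalar_mat A"
proof -
  obtain n S T where carrier: "A \<in> carrier_mat n n" "B \<in> carrier_mat n n"
      "S \<in> carrier_mat n n" "T \<in> carrier_mat n n"
    and ST: "S * T = 1\<^sub>m n" and A: "A = S * B * T"
    using similar_matD[OF assms(1)] by auto
  obtain b where "B = b \<cdot>\<^sub>m 1\<^sub>m n"
    using assms(2) carrier by (auto simp: scalar_mat_def)
  then have "A = b \<cdot>\<^sub>m (S * T)"
    using carrier
    by (simp add: A mult_smult_distrib[OF _ one_carrier_mat] mult_smult_assoc_mat[of S n n T n])
  then have "A = b \<cdot>\<^sub>m 1\<^sub>m n"
    using ST by simp
  then show ?thesis
    by (auto simp: scalar_mat_def)
qed

lemma scalar_mat_add:
  assumes "scalar_mat A" "scalar_mat B" "A \<in> carrier_mat n n" "B \<in> carrier_mat n n"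
  shows "scalar_mat (A + B)"
proof -
  obtain a b where "A = a \<cdot>\<^sub>m 1\<^sub>m n" "B = b \<cdot>\<^sub>m 1\<^sub>m n"
    using assms by (auto simp: scalar_mat_def)
  then have "A + B = (a + b) \<cdot>\<^sub>m 1\<^sub>m n"
    by (simp add: add_smult_distrib_right_mat[where nr = n and nc = n])
  then show ?thesis
    using assms by (auto simp: scalar_mat_def)
qed

lemma scalar_mat_pow:
  fixes A :: "'a :: comm_semiring_1 mat"
  assumes "scalar_mat A"
  shows "scalar_mat (A ^\<^sub>m k)"
proof -
  obtain a n where A: "A = a \<cdot>\<^sub>m 1\<^sub>m n"
    using assms by (auto simp: scalar_mat_def)
  have "A ^\<^sub>m k = a ^ k \<cdot>\<^sub>m 1\<^sub>m n"
    by (induction k) (auto simp: A mult.commute)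
  then show ?thesis
    by (auto simp: scalar_mat_def)
qed

lemma nonscalar_sum_of_two_powers_cases:
  assumes A: "A \<in> sums_of_two_powers n k" and nonscalar: "\<not> scalar_mat A"
  obtains (scalar_summand) S X where "scalar_mat S" "S \<in> carrier_mat n n"
      "X \<in> mat_powers n k" "\<not> scalar_mat X" "A = S + X"
    | (nonscalar_summands) X Y where "X \<in> mat_powers n k" "\<not> scalar_mat X"
      "Y \<in> mat_powers n k" "\<not> scalar_mat Y" "A = X + Y"
proof -
  obtain X Y where X: "X \<in> mat_powers n k" and Y: "Y \<in> mat_powers n k" and A_eq: "A = X + Y"
    using A by (auto simp: sums_of_two_powers_eq)
  note carrier = X[THEN mat_powers_carrier] Y[THEN mat_powers_carrier]
  consider (left) "scalar_mat X" "\<not> scalar_mat Y" | (right) "scalar_mat Y" "\<not> scalar_mat X"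
    | (neither) "\<not> scalar_mat X" "\<not> scalar_mat Y"
    using scalar_mat_add[OF _ _ carrier] nonscalar A_eq by blast
  then show thesis
  proof cases
    case left
    then show thesis using scalar_summand carrier(1) Y A_eq by blast
  next
    case right
    then show thesis using scalar_summand carrier(2) X A_eq comm_add_mat[OF carrier] by blast
  next
    case neither
    then show thesis using nonscalar_summands X Y A_eq by blast
  qed
qed

section \<open>Matrices of size two\<close>

lemma mat2_eq_mat:
  "mat2 a b c d = mat 2 2 (\<lambda>(i, j). if i = 0 then if j = 0 then a else b else if j = 0 then c else d)"
  by (rule eq_matI) (auto simp: mat2_def mat_of_rows_list_def numeral_2_eq_2 less_Suc_eq)

lemma mat2_carrier [simp]: "mat2 a b c d \<in> carrier_mat 2 2"
  by (simp add: mat2_eq_mat)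

lemma dim_mat2 [simp]: "dim_row (mat2 a b c d) = 2" "dim_col (mat2 a b c d) = 2"
  by (simp_all add: mat2_eq_mat)

lemma index_mat2 [simp]:
  "mat2 a b c d $$ (0, 0) = a" "mat2 a b c d $$ (0, Suc 0) = b"
  "mat2 a b c d $$ (Suc 0, 0) = c" "mat2 a b c d $$ (Suc 0, Suc 0) = d"
  by (simp_all add: mat2_eq_mat)

lemma mat2_eqI:
  assumes "A \<in> carrier_mat 2 2" and "A $$ (0, 0) = a" "A $$ (0, Suc 0) = b"
    "A $$ (Suc 0, 0) = c" "A $$ (Suc 0, Suc 0) = d"
  shows "A = mat2 a b c d"
  using assms by (intro eq_matI) (auto dest!: less_2_cases)

lemma mat2_exhaust:
  assumes "A \<in> carrier_mat 2 2"
  obtains a b c d where "A = mat2 a b c d"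
  using mat2_eqI[OF assms] by blast

lemma mat2_eq_iff [simp]:
  "mat2 a b c d = mat2 a' b' c' d' \<longleftrightarrow> a = a' \<and> b = b' \<and> c = c' \<and> d = d'"
  by (metis index_mat2)

lemma mat2_add [simp]:
  fixes a b c d :: "'a :: semiring_1"
  shows "mat2 a b c d + mat2 a' b' c' d' = mat2 (a + a') (b + b') (c + c') (d + d')"
  by (rule mat2_eqI) simp_all

lemma mat2_minus [simp]:
  fixes a b c d :: "'a :: ring_1"
  shows "mat2 a b c d - mat2 a' b' c' d' = mat2 (a - a') (b - b') (c - c') (d - d')"
  by (rule mat2_eqI) (simp_all add: minus_carrier_mat)

lemma mat2_smult [simp]:
  fixes a b c d :: "'a :: semiring_1"
  shows "r \<cdot>\<^sub>m mat2 a b c d = mat2 (r * a) (r * b) (r * c) (r * d)"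
  by (rule mat2_eqI) simp_all

lemma mat2_mult [simp]:
  fixes a b c d :: "'a :: semiring_1"
  shows "mat2 a b c d * mat2 a' b' c' d' =
    mat2 (a * a' + b * c') (a * b' + b * d') (c * a' + d * c') (c * b' + d * d')"
proof -
  have "{0..<2} = {0, Suc 0}" by auto
  then show ?thesis
    by (intro mat2_eqI mult_carrier_mat[of _ 2 2]) (simp_all add: scalar_prod_def)
qed

lemma one_mat_2: "1\<^sub>m 2 = mat2 1 0 0 1"
  by (rule mat2_eqI) simp_all

lemma zero_mat_2: "0\<^sub>m 2 2 = mat2 0 0 0 0"
  by (rule mat2_eqI) simp_all

lemma mat_trace_mat2 [simp]: "mat_trace (mat2 a b c d) = a + d"
  by (simp add: mat_trace_def numeral_2_eq_2)

lemma det_mat2 [simp]: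
  fixes a b c d :: "'a :: comm_ring_1"
  shows "det (mat2 a b c d) = a * d - b * c"
proof -
  have minor: "det (mat_delete (mat2 a b c d) i 0) = mat_delete (mat2 a b c d) i 0 $$ (0, 0)" for i
    by (rule det_single) (simp add: mat_delete_def)
  have "det (mat2 a b c d) = (\<Sum>i<2. mat2 a b c d $$ (i, 0) * cofactor (mat2 a b c d) i 0)"
    by (rule laplace_expansion_column) simp_all
  also have "\<dots> = a * d - b * c"
    by (simp add: numeral_2_eq_2 cofactor_def minor) (simp add: mat_delete_def)
  finally show ?thesis .
qed

lemma scalar_mat2_iff [simp]: "scalar_mat (mat2 a b c d) \<longleftrightarrow> b = 0 \<and> c = 0 \<and> a = d"
  by (auto simp: scalar_mat_def one_mat_2)

lemma cayley_hamilton_mat2: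
  fixes A :: "'a :: comm_ring_1 mat"
  assumes "A \<in> carrier_mat 2 2"
  shows "A ^\<^sub>m 2 = mat_trace A \<cdot>\<^sub>m A - det A \<cdot>\<^sub>m 1\<^sub>m 2"
  using assms
  by (elim mat2_exhaust) (simp add: pow_mat_2[where n = 2] one_mat_2 algebra_simps)

lemma mat2_pow_3:
  fixes A :: "'a :: comm_ring_1 mat"
  assumes "A \<in> carrier_mat 2 2"
  shows "A ^\<^sub>m 3 = ((mat_trace A)\<^sup>2 - det A) \<cdot>\<^sub>m A - (mat_trace A * det A) \<cdot>\<^sub>m 1\<^sub>m 2"
  using assms
  by (elim mat2_exhaust) (simp add: numeral_3_eq_3 one_mat_2 algebra_simps power2_eq_square)

lemma mat_trace_mat2_pow_2:
  fixes A :: "'a :: comm_ring_1 mat"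
  assumes "A \<in> carrier_mat 2 2"
  shows "mat_trace (A ^\<^sub>m 2) = (mat_trace A)\<^sup>2 - 2 * det A"
  using assms
  by (elim mat2_exhaust) (simp add: pow_mat_2[where n = 2] algebra_simps power2_eq_square)

lemma mat_trace_mat2_pow_3:
  fixes A :: "'a :: comm_ring_1 mat"
  assumes "A \<in> carrier_mat 2 2"
  shows "mat_trace (A ^\<^sub>m 3) = mat_trace A ^ 3 - 3 * mat_trace A * det A"
  using assms
  by (elim mat2_exhaust) (simp add: numeral_3_eq_3 algebra_simps)

lemma scalar_mat2_pow_2:
  fixes A :: "'a :: comm_ring_1 mat"
  assumes "A \<in> carrier_mat 2 2" and "mat_trace A = 0"
  shows "scalar_mat (A ^\<^sub>m 2)"
  unfolding cayley_hamilton_mat2[OF assms(1)] assms(2) using assms(1)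
  by (elim mat2_exhaust) (simp add: one_mat_2)

lemma scalar_mat2_pow_3:
  fixes A :: "'a :: comm_ring_1 mat"
  assumes "A \<in> carrier_mat 2 2" and "(mat_trace A)\<^sup>2 = det A"
  shows "scalar_mat (A ^\<^sub>m 3)"
  unfolding mat2_pow_3[OF assms(1)] assms(2) using assms(1)
  by (elim mat2_exhaust) (simp add: one_mat_2)

lemma mat2_pow_2_singular:
  fixes A :: "'a :: comm_ring_1 mat"
  assumes "A \<in> carrier_mat 2 2" and "det A = 0"
  shows "A ^\<^sub>m 2 = mat_trace A \<cdot>\<^sub>m A"
  unfolding cayley_hamilton_mat2[OF assms(1)] assms(2) using assms(1)
  by (elim mat2_exhaust) (simp add: one_mat_2)

lemma mat_trace_mat2_pow_singular:
  fixes A :: "'a :: comm_ring_1 mat"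
  assumes "A \<in> carrier_mat 2 2" and "det A = 0"
  shows "mat_trace (A ^\<^sub>m Suc k) = mat_trace A ^ Suc k"
proof -
  obtain a b c d where A: "A = mat2 a b c d"
    using assms(1) by (rule mat2_exhaust)
  have "A ^\<^sub>m Suc k = mat_trace A ^ k \<cdot>\<^sub>m A"
  proof (induction k)
    case 0
    show ?case by (simp add: A)
  next
    case (Suc k)
    have "A ^\<^sub>m Suc (Suc k) = mat_trace A ^ k \<cdot>\<^sub>m A ^\<^sub>m 2"
      using assms(1) Suc by (simp add: pow_mat_2[OF assms(1)] mult_smult_assoc_mat[of A 2 2 A 2])
    then show ?case
      unfolding mat2_pow_2_singular[OF assms] by (simp add: A mult.assoc mult.left_commute)
  qed
  then show ?thesis
    by (simp add: A algebra_simps)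
qed

definition nonscalar_mats :: "'a :: comm_ring_1 \<Rightarrow> 'a \<Rightarrow> 'a mat set" where
  "nonscalar_mats t \<delta> =
    {A \<in> carrier_mat 2 2. \<not> scalar_mat A \<and> mat_trace A = t \<and> det A = \<delta>}"

lemma nilpotent_mat2_iff:
  fixes A :: "'a :: field mat"
  assumes A: "A \<in> carrier_mat 2 2"
  shows "nilpotent_mat A \<longleftrightarrow> mat_trace A = 0 \<and> det A = 0"
proof
  assume "nilpotent_mat A"
  then obtain n where n: "A ^\<^sub>m n = 0\<^sub>m 2 2"
    using A by (auto simp: nilpotent_mat_def)
  then have "det A ^ n = 0"
    using det_pow_mat[OF A, of n] by simp
  then have det: "det A = 0" by simp
  have "A ^\<^sub>m Suc n = 0\<^sub>m 2 2"
    using n A by simp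
  then have "mat_trace A ^ Suc n = 0"
    using mat_trace_mat2_pow_singular[OF A det, of n] by (simp add: zero_mat_2 del: pow_mat.simps)
  then show "mat_trace A = 0 \<and> det A = 0"
    using det by auto
next
  assume "mat_trace A = 0 \<and> det A = 0"
  then have "A ^\<^sub>m 2 = 0 \<cdot>\<^sub>m A"
    using mat2_pow_2_singular[OF A] by simp
  then have "A ^\<^sub>m 2 = 0\<^sub>m 2 2"
    using A by (elim mat2_exhaust) (simp add: zero_mat_2)
  then show "nilpotent_mat A"
    using A by (auto simp: nilpotent_mat_def)
qed

lemma nonzero_nilpotent_mats_eq:
  "{A \<in> carrier_mat 2 2. nilpotent_mat A \<and> A \<noteq> 0\<^sub>m 2 2} = nonscalar_mats 0 (0 :: 'a :: field)"
proof -
  have "scalar_mat A \<longleftrightarrow> A = 0\<^sub>m 2 2"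
    if "A \<in> carrier_mat 2 2" and "det A = 0" for A :: "'a mat"
    using that by (elim mat2_exhaust) (auto simp: zero_mat_2)
  then show ?thesis
    by (auto simp: nonscalar_mats_def nilpotent_mat2_iff)
qed

abbreviation companion2 :: "'a :: comm_ring_1 \<Rightarrow> 'a \<Rightarrow> 'a mat" where
  "companion2 t \<delta> \<equiv> mat2 0 (- \<delta>) 1 t"

lemma similar_companion2:
  fixes A :: "'a :: field mat"
  assumes "A \<in> nonscalar_mats t \<delta>"
  shows "similar_mat A (companion2 t \<delta>)"
proof -
  obtain a b c d where A: "A = mat2 a b c d" and nonscalar: "\<not> (b = 0 \<and> c = 0 \<and> a = d)"
    and t: "t = a + d" and \<delta>: "\<delta> = a * d - b * c"
    using assms by (auto simp: nonscalar_mats_def elim!: mat2_exhaust)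
  \<comment> \<open>The columns of the transition matrix are \<open>v = (x, y)\<close> and \<open>A v\<close>. A non-scalar matrix does not
    have all of \<open>(1, 0)\<close>, \<open>(0, 1)\<close> and \<open>(1, 1)\<close> as eigenvectors.\<close>
  define S where "S x y = mat2 x (a * x + b * y) y (c * x + d * y)" for x y
  have "det (S 1 0) \<noteq> 0 \<or> det (S 0 1) \<noteq> 0 \<or> det (S 1 1) \<noteq> 0"
    using nonscalar by (auto simp: S_def)
  then obtain x y where "det (S x y) \<noteq> 0" by blast
  moreover have "A * S x y = S x y * companion2 t \<delta>"
    by (simp add: A S_def t \<delta> algebra_simps)
  ultimately show ?thesis
    by (intro similar_matI_intertwine[where n = 2 and S = "S x y"]) (simp_all add: A S_def)
qed

lemma conj_class_eq_nonscalar_mats: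
  fixes A :: "'a :: field mat"
  assumes A: "A \<in> nonscalar_mats t \<delta>"
  shows "conj_class A = nonscalar_mats t \<delta>"
proof (intro equalityI subsetI)
  fix B
  assume "B \<in> conj_class A"
  then have sim: "similar_mat B A"
    by (simp add: conj_class_def)
  then have "\<not> scalar_mat B"
    using scalar_mat_similar[OF similar_mat_sym] A by (auto simp: nonscalar_mats_def)
  with sim show "B \<in> nonscalar_mats t \<delta>"
    using A similar_mat_carrier mat_trace_similar det_similar by (auto simp: nonscalar_mats_def)
next
  fix B
  assume "B \<in> nonscalar_mats t \<delta>"
  then show "B \<in> conj_class A"
    using similar_companion2 A similar_mat_trans similar_mat_sym
    unfolding conj_class_def by blast
qed

lemma trace_det_scalar_add:
  fixes X :: "'a :: comm_ring_1 mat"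
  assumes "X \<in> carrier_mat 2 2"
  shows "mat_trace (a \<cdot>\<^sub>m 1\<^sub>m 2 + X) = 2 * a + mat_trace X"
    and "det (a \<cdot>\<^sub>m 1\<^sub>m 2 + X) = a\<^sup>2 + a * mat_trace X + det X"
  using assms by (auto elim!: mat2_exhaust simp: one_mat_2 algebra_simps power2_eq_square)

lemma sum_squares_if_trace_0_det_1_add_singular:
  fixes a b c d p q r s :: "'a :: comm_ring_1"
  assumes "a + d = 0" "p + s = 0"
    and dets: "a * d - b * c = 1" "p * s - q * r = 1" "(a + p) * (d + s) - (b + q) * (c + r) = 0"
  shows "(a * q - b * p)\<^sup>2 + (b + q)\<^sup>2 = 0"
proof -
  have d: "d = - a" and s: "s = - p"
    using assms(1,2) by (simp_all add: eq_neg_iff_add_eq_0 add.commute)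
  have "(a * q - b * p)\<^sup>2 + (b + q)\<^sup>2 =
      (1 - (a * d - b * c)) * (q\<^sup>2 + b * q) + (1 - (p * s - q * r)) * (b\<^sup>2 + b * q)
      + ((a + p) * (d + s) - (b + q) * (c + r)) * (b * q)"
    by (simp add: d s algebra_simps power2_eq_square)
  then show ?thesis
    unfolding dets by simp
qed

section \<open>The field with three elements\<close>

locale three_element_field =
  fixes ty :: "'f :: field itself"
  assumes card_UNIV: "CARD('f) = 3"
begin

lemma three_eq_zero: "(3 :: 'f) = 0"
proof -
  have "CHAR('f) dvd 3"
    using CHAR_dvd_CARD[where 'a = 'f] card_UNIV by simp
  then show ?thesis
    using of_nat_eq_0_iff_char_dvd[of 3, where 'a = 'f] by simp
qed

lemma numeral_simps [simp]:
  "(3 :: 'f) = 0" "(4 :: 'f) = 1" "(- 1 :: 'f) = 2" "(- 2 :: 'f) = 1"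
  "(2 :: 'f) \<noteq> 0" "(0 :: 'f) \<noteq> 2" "(2 :: 'f) \<noteq> 1" "(1 :: 'f) \<noteq> 2"
proof -
  have eqs: "(4 :: 'f) = 3 + 1" "(- 1 :: 'f) = 2 - 3" "(- 2 :: 'f) = 1 - 3" "(3 :: 'f) = 2 + 1"
    by simp_all
  show "(3 :: 'f) = 0" "(4 :: 'f) = 1" "(- 1 :: 'f) = 2" "(- 2 :: 'f) = 1"
    using eqs(1-3) by (simp_all add: three_eq_zero)
  show "(2 :: 'f) \<noteq> 0" "(0 :: 'f) \<noteq> 2"
    using eqs(4) three_eq_zero by (metis add_0 zero_neq_one)+
  show "(2 :: 'f) \<noteq> 1" "(1 :: 'f) \<noteq> 2"
    by (metis add_cancel_left_left one_add_one zero_neq_one)+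
qed

lemma diff_two_mult [simp]: "x - 2 * y = x + (y :: 'f)"
proof -
  have "x - 2 * y = x + (- 2) * y" by (simp only: mult_minus_left diff_conv_add_uminus)
  then show ?thesis by (simp only: numeral_simps mult_1)
qed

lemma element_cases:
  obtains (zero) "x = 0" | (one) "x = 1" | (two) "x = (2 :: 'f)"
proof -
  have "{0, 1, 2} = (UNIV :: 'f set)"
    using card_UNIV by (intro card_subset_eq) (simp_all add: card_ge_0_finite)
  then show thesis
    using that by blast
qed

lemma square_eq_one: "x \<noteq> 0 \<Longrightarrow> x\<^sup>2 = (1 :: 'f)"
  by (cases x rule: element_cases) simp_all

lemma cube_eq_self: "x ^ 3 = (x :: 'f)"
  by (cases x rule: element_cases) (simp_all add: power3_eq_cube)

lemma sum_squares_eq_zero_iff: "x\<^sup>2 + y\<^sup>2 = 0 \<longleftrightarrow> x = 0 \<and> y = (0 :: 'f)"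
  by (cases x rule: element_cases; cases y rule: element_cases) simp_all

subsection \<open>Matrices that are powers\<close>

lemma trace_2_det_0_mem_mat_powers:
  fixes A :: "'f mat"
  assumes "odd k" and A: "A \<in> carrier_mat 2 2" and tr_det: "mat_trace A = 2" "det A = 0"
  shows "A \<in> mat_powers 2 k"
proof (rule mat_powers_coprime_period[OF A])
  show "A ^\<^sub>m (2 + 1) = A"
    using A mat2_pow_3[OF A] by (auto simp: tr_det one_mat_2 elim!: mat2_exhaust)
qed (use \<open>odd k\<close> in \<open>auto intro: odd_pos\<close>)

lemma trace_2_det_1_mem_mat_powers:
  fixes A :: "'f mat"
  assumes "\<not> 3 dvd k" and A: "A \<in> carrier_mat 2 2" and tr_det: "mat_trace A = 2" "det A = 1"
  shows "A \<in> mat_powers 2 k"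
proof (rule mat_powers_coprime_period[OF A])
  have "A ^\<^sub>m 3 = 1\<^sub>m 2"
    using A mat2_pow_3[OF A] by (auto simp: tr_det one_mat_2 elim!: mat2_exhaust)
  then show "A ^\<^sub>m (3 + 1) = A"
    using A pow_mat_add[OF A, of 3 1] by simp
  show "coprime k 3"
    using \<open>\<not> 3 dvd k\<close> prime_imp_coprime[of 3 k] by (simp add: coprime_commute)
  show "k > 0"
    using \<open>\<not> 3 dvd k\<close> by (cases k) auto
qed

lemma trace_0_det_1_pow_4:
  fixes A :: "'f mat"
  assumes A: "A \<in> carrier_mat 2 2" and tr_det: "mat_trace A = 0" "det A = 1"
  shows "A ^\<^sub>m 4 = 1\<^sub>m 2"
proof -
  have "A ^\<^sub>m 2 = 2 \<cdot>\<^sub>m 1\<^sub>m 2"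
    using A cayley_hamilton_mat2[OF A] by (auto simp: tr_det one_mat_2 elim!: mat2_exhaust)
  moreover have "A ^\<^sub>m 4 = A ^\<^sub>m 2 * A ^\<^sub>m 2"
    using pow_mat_add[OF A, of 2 2] by simp
  ultimately show ?thesis
    by (simp add: one_mat_2)
qed

lemma trace_0_det_1_square_root:
  fixes A :: "'f mat"
  assumes A: "A \<in> carrier_mat 2 2" and tr_det: "mat_trace A = 0" "det A = 1"
  obtains B where "B \<in> carrier_mat 2 2" "B ^\<^sub>m 2 = A"
proof
  let ?B = "2 \<cdot>\<^sub>m 1\<^sub>m 2 + A"
  show B: "?B \<in> carrier_mat 2 2"
    using A by simp
  have "mat_trace ?B = 1" "det ?B = 2"
    using trace_det_scalar_add[OF A, of 2] by (simp_all add: tr_det)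
  then show "?B ^\<^sub>m 2 = A"
    using A cayley_hamilton_mat2[OF B] by (auto simp: one_mat_2 elim!: mat2_exhaust)
qed

lemma trace_0_det_1_mem_mat_powers:
  fixes A :: "'f mat"
  assumes k: "\<not> 4 dvd k" and A: "A \<in> carrier_mat 2 2" and tr_det: "mat_trace A = 0" "det A = 1"
  shows "A \<in> mat_powers 2 k"
proof (cases "even k")
  case False
  have "coprime k 4"
    using False coprime_power_right_iff[of k 2 2] by simp
  moreover have "A ^\<^sub>m (4 + 1) = A"
    using A trace_0_det_1_pow_4[OF A tr_det] pow_mat_add[OF A, of 4 1] by simp
  ultimately show ?thesis
    using mat_powers_coprime_period[OF A] odd_pos[OF False] by blast
next
  case True
  then obtain j where k_eq: "k = j * 2"
    by (metis evenE mult.commute)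
  then have "odd j" using k by auto
  obtain B where B: "B \<in> carrier_mat 2 2" and B_square: "B ^\<^sub>m 2 = A"
    using trace_0_det_1_square_root[OF A tr_det] .
  have "B ^\<^sub>m 8 = 1\<^sub>m 2"
    using pow_mat_mult[OF B, of 2 4] trace_0_det_1_pow_4[OF A tr_det] by (simp add: B_square)
  then have "B ^\<^sub>m (8 + 1) = B"
    using B pow_mat_add[OF B, of 8 1] by simp
  moreover have "coprime j 8"
    using \<open>odd j\<close> coprime_power_right_iff[of j 2 3] by simp
  ultimately have "B \<in> mat_powers 2 j"
    using mat_powers_coprime_period[OF B] odd_pos[OF \<open>odd j\<close>] by blast
  then show ?thesis
    using B_square by (auto simp: k_eq mat_powers_mult)
qed

subsection \<open>Sixth and twelfth powers\<close>

lemma mat_powers_6_shape: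
  fixes X :: "'f mat"
  assumes "X \<in> mat_powers 2 6"
  shows "scalar_mat X \<or> mat_trace X = 1 \<and> det X = 0 \<or> mat_trace X = 0 \<and> det X = 1"
proof -
  obtain A where A: "A \<in> carrier_mat 2 2" and "X = A ^\<^sub>m 6"
    using assms by (auto simp: mat_powers_def)
  then have X_eq_cube: "X = (A ^\<^sub>m 2) ^\<^sub>m 3" and X_eq_square: "X = (A ^\<^sub>m 3) ^\<^sub>m 2"
    using pow_mat_mult[OF A, of 2 3] pow_mat_mult[OF A, of 3 2] by simp_all
  have trace: "mat_trace X = (mat_trace A)\<^sup>2 + det A"
    using A by (simp add: X_eq_cube mat_trace_mat2_pow_3 mat_trace_mat2_pow_2 cube_eq_self)
  have det: "det X = (det A)\<^sup>2"
    using A by (simp add: X_eq_cube det_pow_mat[of _ 2] cube_eq_self)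
  show ?thesis
  proof (cases "mat_trace A = 0 \<or> det A = 1")
    case True
    then have "scalar_mat (A ^\<^sub>m 2) \<or> scalar_mat (A ^\<^sub>m 3)"
      using scalar_mat2_pow_2[OF A] scalar_mat2_pow_3[OF A] square_eq_one by fastforce
    then have "scalar_mat X"
      using scalar_mat_pow X_eq_cube X_eq_square by metis
    then show ?thesis ..
  next
    case False
    then have "mat_trace X = 1 + det A"
      using trace square_eq_one by simp
    moreover have "det A = 0 \<or> det A = 2"
      using False by (cases "det A" rule: element_cases) auto
    ultimately show ?thesis
      using det by auto
  qed
qed

lemma mat_powers_12_shape:
  fixes X :: "'f mat"
  assumes "X \<in> mat_powers 2 12"
  shows "scalar_mat X \<or> mat_trace X = 1 \<and> det X = 0"
proof -
  have "mat_powers 2 12 = (\<lambda>Y :: 'f mat. Y ^\<^sub>m 2) ` mat_powers 2 6"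
    using mat_powers_mult[of 2 6 2] by simp
  then obtain Y where Y: "Y \<in> mat_powers 2 6" and X: "X = Y ^\<^sub>m 2"
    using assms by auto
  note Y_carrier = mat_powers_carrier[OF Y]
  consider (scalar) "scalar_mat Y" | (idempotent) "mat_trace Y = 1" "det Y = 0"
    | (traceless) "mat_trace Y = 0"
    using mat_powers_6_shape[OF Y] by blast
  then show ?thesis
  proof cases
    case scalar
    then show ?thesis using scalar_mat_pow X by blast
  next
    case idempotent
    then show ?thesis
      using mat_trace_mat2_pow_2[OF Y_carrier] det_pow_mat[OF Y_carrier] X by simp
  next
    case traceless
    then show ?thesis using scalar_mat2_pow_2[OF Y_carrier] X by blast
  qed
qed

subsection \<open>Sums of two powers\<close>

lemma trace_det_scalar_add_cases:
  fixes X :: "'f mat"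
  assumes "scalar_mat S" "S \<in> carrier_mat 2 2" and X: "X \<in> carrier_mat 2 2"
  shows "mat_trace X = 1 \<Longrightarrow> det X = 0 \<Longrightarrow>
      (mat_trace (S + X), det (S + X)) \<in> {(1, 0), (0, 2), (2, 0)}"
    and "mat_trace X = 0 \<Longrightarrow> det X = 1 \<Longrightarrow>
      (mat_trace (S + X), det (S + X)) \<in> {(0, 1), (2, 2), (1, 2)}"
proof -
  obtain a where "S = a \<cdot>\<^sub>m 1\<^sub>m 2"
    using assms by (auto simp: scalar_mat_def)
  note trace_det = trace_det_scalar_add[OF X, of a, folded this]
  show "(mat_trace (S + X), det (S + X)) \<in> {(1, 0), (0, 2), (2, 0)}"
    if "mat_trace X = 1" "det X = 0"
    by (cases a rule: element_cases) (simp_all add: trace_det that)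
  show "(mat_trace (S + X), det (S + X)) \<in> {(0, 1), (2, 2), (1, 2)}"
    if "mat_trace X = 0" "det X = 1"
    by (cases a rule: element_cases) (simp_all add: trace_det that)
qed

lemma add_eq_zero_if_trace_0_det_1:
  fixes X Y :: "'f mat"
  assumes "X \<in> carrier_mat 2 2" "Y \<in> carrier_mat 2 2"
    and "mat_trace X = 0" "det X = 1" "mat_trace Y = 0" "det Y = 1" and "det (X + Y) = 0"
  shows "X + Y = 0\<^sub>m 2 2"
proof -
  obtain a b c d p q r s where X: "X = mat2 a b c d" and Y: "Y = mat2 p q r s"
    using assms(1,2) by (metis mat2_exhaust)
  have traces: "a + d = 0" "p + s = 0"
    and dets: "a * d - b * c = 1" "p * s - q * r = 1" "(a + p) * (d + s) - (b + q) * (c + r) = 0"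
    using assms(3-7) by (simp_all add: X Y)
  have "(a * q - b * p)\<^sup>2 + (b + q)\<^sup>2 = 0"
    using traces dets by (rule sum_squares_if_trace_0_det_1_add_singular)
  moreover have "(a * r - c * p)\<^sup>2 + (c + r)\<^sup>2 = 0"
    using sum_squares_if_trace_0_det_1_add_singular[OF traces, of c b r q] dets
    by (simp add: mult.commute)
  ultimately have off_diagonal: "b + q = 0" "c + r = 0"
    by (simp_all add: sum_squares_eq_zero_iff)
  have "(a + p) + (d + s) = 0"
    using traces by (simp add: algebra_simps)
  moreover have "(a + p) * (d + s) = 0"
    using dets(3) off_diagonal by simp
  ultimately have "a + p = 0" "d + s = 0"
    by auto
  then show ?thesis
    by (simp add: X Y off_diagonal zero_mat_2)
qed

lemma sums_of_two_powers_6_trace_det: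
  fixes A :: "'f mat"
  assumes "A \<in> sums_of_two_powers 2 6" and "\<not> scalar_mat A"
  shows "(mat_trace A, det A) \<noteq> (0, 0)"
  using assms
proof (cases rule: nonscalar_sum_of_two_powers_cases)
  case (scalar_summand S X)
  then show ?thesis
    using mat_powers_6_shape[of X] mat_powers_carrier[of X 2 6] trace_det_scalar_add_cases[of S X]
    by auto
next
  case (nonscalar_summands X Y)
  then have carrier: "X \<in> carrier_mat 2 2" "Y \<in> carrier_mat 2 2"
    by (simp_all add: mat_powers_carrier)
  show ?thesis
  proof
    assume zero: "(mat_trace A, det A) = (0, 0)"
    then have "mat_trace X + mat_trace Y = 0"
      using mat_trace_add[OF carrier] nonscalar_summands(5) by simp
    then have "mat_trace X = 0" "det X = 1" "mat_trace Y = 0" "det Y = 1"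
      using mat_powers_6_shape[of X] mat_powers_6_shape[of Y] nonscalar_summands by auto
    then have "A = 0\<^sub>m 2 2"
      using add_eq_zero_if_trace_0_det_1[OF carrier] zero nonscalar_summands(5) by simp
    then show False
      using assms(2) by (simp add: zero_mat_2)
  qed
qed

lemma sums_of_two_powers_12_trace_det:
  fixes A :: "'f mat"
  assumes "A \<in> sums_of_two_powers 2 12" and "\<not> scalar_mat A"
  shows "mat_trace A = 2 \<or> (mat_trace A, det A) \<in> {(1, 0), (0, 2)}"
  using assms
proof (cases rule: nonscalar_sum_of_two_powers_cases)
  case (scalar_summand S X)
  then show ?thesis
    using mat_powers_12_shape[of X] mat_powers_carrier[of X 2 12] trace_det_scalar_add_cases(1)[of S X]
    by auto
next
  case (nonscalar_summands X Y)
  then have "mat_trace A = mat_trace X + mat_trace Y"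
    by (simp add: mat_trace_add[of X 2] mat_powers_carrier)
  then show ?thesis
    using mat_powers_12_shape[of X] mat_powers_12_shape[of Y] nonscalar_summands by simp
qed

lemma scalar_mem_sums_of_two_powers:
  fixes A :: "'f mat"
  assumes "A \<in> carrier_mat 2 2" and "scalar_mat A" and "k > 0"
  shows "A \<in> sums_of_two_powers 2 k"
proof -
  obtain a where A: "A = mat2 a 0 0 a"
    using assms by (auto elim!: mat2_exhaust)
  note idem = idempotent_mem_mat_powers[OF mat2_carrier _ \<open>k > 0\<close>]
  show ?thesis
  proof (cases a rule: element_cases)
    case zero
    then show ?thesis
      by (intro sums_of_two_powersI[OF idem[of 0 0 0 0] idem[of 0 0 0 0]]) (simp_all add: A)
  next
    case one
    then show ?thesis
      by (intro sums_of_two_powersI[OF idem[of 1 0 0 1] idem[of 0 0 0 0]]) (simp_all add: A)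
  next
    case two
    then show ?thesis
      by (intro sums_of_two_powersI[OF idem[of 1 0 0 1] idem[of 1 0 0 1]]) (simp_all add: A)
  qed
qed

lemma companion2_mem_sum_of_idempotents:
  assumes "k > 0"
  shows "companion2 (2 :: 'f) \<delta> \<in> sums_of_two_powers 2 k"
    and "companion2 (1 :: 'f) 0 \<in> sums_of_two_powers 2 k"
    and "companion2 (0 :: 'f) 2 \<in> sums_of_two_powers 2 k"
proof -
  note idem = idempotent_mem_mat_powers[OF mat2_carrier _ assms]
  show "companion2 (2 :: 'f) \<delta> \<in> sums_of_two_powers 2 k"
    by (rule sums_of_two_powersI[OF idem[of 0 0 1 1] idem[of 0 "- \<delta>" 0 1]]) simp_all
  show "companion2 (1 :: 'f) 0 \<in> sums_of_two_powers 2 k"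
    by (rule sums_of_two_powersI[OF idem[of 0 0 1 1] idem[of 0 0 0 0]]) simp_all
  show "companion2 (0 :: 'f) 2 \<in> sums_of_two_powers 2 k"
    by (rule sums_of_two_powersI[OF idem[of 1 0 0 1] idem[of 2 1 1 2]]) simp_all
qed

lemma companion2_mem_if_not_12_dvd:
  assumes "\<not> 12 dvd k" and t\<delta>: "(t, \<delta>) \<in> {(1, 1), (0, 1), (1, 2 :: 'f)}"
  shows "companion2 t \<delta> \<in> sums_of_two_powers 2 k"
proof -
  have "k > 0" using assms(1) by (cases k) auto
  note idem = idempotent_mem_mat_powers[OF mat2_carrier _ this]
  have "\<not> 4 dvd k \<or> \<not> 3 dvd k"
    using assms(1) by presburger
  then show ?thesis
  proof
    assume "\<not> 4 dvd k"
    then have order_4: "mat2 0 2 1 (0 :: 'f) \<in> mat_powers 2 k"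
      by (rule trace_0_det_1_mem_mat_powers) simp_all
    have "companion2 1 (1 :: 'f) \<in> sums_of_two_powers 2 k"
      by (rule sums_of_two_powersI[OF idem[of 0 0 0 1] order_4]) simp_all
    moreover have "companion2 0 (1 :: 'f) \<in> sums_of_two_powers 2 k"
      by (rule sums_of_two_powersI[OF idem[of 0 0 0 0] order_4]) simp_all
    moreover have "companion2 1 (2 :: 'f) \<in> sums_of_two_powers 2 k"
      by (rule sums_of_two_powersI[OF idem[of 0 2 0 1] order_4]) simp_all
    ultimately show ?thesis
      using t\<delta> by auto
  next
    assume "\<not> 3 dvd k"
    note order_3 = trace_2_det_1_mem_mat_powers[OF this mat2_carrier]
    have "companion2 1 (1 :: 'f) \<in> sums_of_two_powers 2 k"
      by (rule sums_of_two_powersI[OF order_3[of 0 1 2 2] order_3[of 0 1 2 2]]) simp_all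
    moreover have "companion2 0 (1 :: 'f) \<in> sums_of_two_powers 2 k"
      by (rule sums_of_two_powersI[OF idem[of 0 0 0 1] order_3[of 0 2 1 2]]) simp_all
    moreover have "companion2 1 (2 :: 'f) \<in> sums_of_two_powers 2 k"
      by (rule sums_of_two_powersI[OF order_3[of 1 2 0 1] order_3[of 2 2 1 0]]) simp_all
    ultimately show ?thesis
      using t\<delta> by auto
  qed
qed

lemma companion2_mem_if_not_6_dvd:
  assumes "\<not> 6 dvd k"
  shows "companion2 (0 :: 'f) 0 \<in> sums_of_two_powers 2 k"
proof -
  have "k > 0" using assms by (cases k) auto
  note idem = idempotent_mem_mat_powers[OF mat2_carrier _ this]
  have "odd k \<or> \<not> 3 dvd k"
    using assms by presburger
  then show ?thesis
  proof
    assume "odd k"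
    note minus_idem = trace_2_det_0_mem_mat_powers[OF this mat2_carrier]
    show ?thesis
      by (rule sums_of_two_powersI[OF idem[of 0 0 1 1] minus_idem[of 0 0 0 2]]) simp_all
  next
    assume "\<not> 3 dvd k"
    note order_3 = trace_2_det_1_mem_mat_powers[OF this mat2_carrier]
    show ?thesis
      by (rule sums_of_two_powersI[OF idem[of 0 1 0 1] order_3[of 0 2 1 2]]) simp_all
  qed
qed

definition missed_invariants :: "nat \<Rightarrow> ('f \<times> 'f) set" where
  "missed_invariants k =
    (if 6 dvd k then {(0, 0)} else {}) \<union> (if 12 dvd k then {(1, 1), (0, 1), (1, 2)} else {})"

lemma companion2_mem_sums_of_two_powers:
  assumes "k > 0" and "(t, \<delta>) \<notin> missed_invariants k"
  shows "companion2 t \<delta> \<in> sums_of_two_powers 2 k"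
proof -
  consider (trace_2) "t = 2" | (idempotents) "(t, \<delta>) \<in> {(1, 0), (0, 2)}"
    | (not_12_dvd) "(t, \<delta>) \<in> {(1, 1), (0, 1), (1, 2)}"
    | (nilpotent) "(t, \<delta>) = (0, 0)"
    by (cases t rule: element_cases; cases \<delta> rule: element_cases) auto
  then show ?thesis
  proof cases
    case not_12_dvd
    then have "\<not> 12 dvd k"
      using assms(2) by (auto simp: missed_invariants_def)
    then show ?thesis
      using not_12_dvd by (rule companion2_mem_if_not_12_dvd)
  next
    case nilpotent
    then have "\<not> 6 dvd k"
      using assms(2) by (auto simp: missed_invariants_def)
    then show ?thesis
      using nilpotent companion2_mem_if_not_6_dvd by simp
  qed (use companion2_mem_sum_of_idempotents[OF assms(1)] in auto)
qed

lemma sums_of_two_powers_trace_det: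
  assumes "A \<in> sums_of_two_powers 2 k" and "\<not> scalar_mat A"
  shows "(mat_trace A, det A) \<notin> missed_invariants k"
proof -
  have "(mat_trace A, det A) \<noteq> (0, 0)" if "6 dvd k"
    using sums_of_two_powers_6_trace_det sums_of_two_powers_dvd_antimono[OF that] assms by blast
  moreover have "mat_trace A = 2 \<or> (mat_trace A, det A) \<in> {(1, 0), (0, 2)}" if "12 dvd k"
    using sums_of_two_powers_12_trace_det sums_of_two_powers_dvd_antimono[OF that] assms by blast
  ultimately show ?thesis
    by (auto simp: missed_invariants_def)
qed

theorem sums_of_two_powers_2_eq:
  assumes "k > 0"
  shows "sums_of_two_powers 2 k =
    carrier_mat 2 2 - (\<Union>(t, \<delta>) \<in> missed_invariants k. nonscalar_mats t \<delta>)"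
proof (intro equalityI subsetI)
  fix A :: "'f mat"
  assume A: "A \<in> sums_of_two_powers 2 k"
  then show "A \<in> carrier_mat 2 2 - (\<Union>(t, \<delta>) \<in> missed_invariants k. nonscalar_mats t \<delta>)"
    using sums_of_two_powers_carrier sums_of_two_powers_trace_det[OF A]
    by (auto simp: nonscalar_mats_def)
next
  fix A :: "'f mat"
  assume A: "A \<in> carrier_mat 2 2 - (\<Union>(t, \<delta>) \<in> missed_invariants k. nonscalar_mats t \<delta>)"
  show "A \<in> sums_of_two_powers 2 k"
  proof (cases "scalar_mat A")
    case True
    then show ?thesis
      using A assms by (auto intro: scalar_mem_sums_of_two_powers)
  next
    case False
    then have nonscalar: "A \<in> nonscalar_mats (mat_trace A) (det A)"
      using A by (auto simp: nonscalar_mats_def)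
    then have "(mat_trace A, det A) \<notin> missed_invariants k"
      using A by auto
    then show ?thesis
      using companion2_mem_sums_of_two_powers[OF assms] similar_companion2[OF nonscalar]
      by (blast intro: sums_of_two_powers_similar)
  qed
qed

end

theorem theorem7p2:
  fixes k :: nat
    and P C5 C9 C10 C12 :: "'f :: field mat set"
  assumes F3: "CARD('f) = 3"
    and k: "k \<ge> 2"
    and P: "P = sums_of_two_powers 2 k"
    and C5: "C5 = {A \<in> carrier_mat 2 2. nilpotent_mat A \<and> A \<noteq> 0\<^sub>m 2 2}"
    and C9: "C9 = conj_class (mat2 2 1 0 2)"
    and C10: "C10 = conj_class (mat2 0 2 1 0)"
    and C12: "C12 = conj_class (mat2 0 1 1 1)"
  shows "(k mod 24 \<notin> {0, 6, 12, 18} \<longrightarrow> P = carrier_mat 2 2) \<and>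
         (k mod 24 \<in> {6, 18} \<longrightarrow> P = carrier_mat 2 2 - C5) \<and>
         (k mod 12 = 0 \<longrightarrow> P = carrier_mat 2 2 - (C5 \<union> C9 \<union> C10 \<union> C12))"
proof -
  interpret three_element_field "TYPE('f)"
    by unfold_locales (fact F3)
  have "C5 = nonscalar_mats 0 0"
    unfolding C5 by (rule nonzero_nilpotent_mats_eq)
  moreover have "C9 = nonscalar_mats 1 1" "C10 = nonscalar_mats 0 1" "C12 = nonscalar_mats 1 2"
    unfolding C9 C10 C12
    by (rule conj_class_eq_nonscalar_mats; simp add: nonscalar_mats_def)+
  moreover have "P = carrier_mat 2 2 - (\<Union>(t, \<delta>) \<in> missed_invariants k. nonscalar_mats t \<delta>)"
    unfolding P using k by (intro sums_of_two_powers_2_eq) simp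
  moreover have "k mod 24 \<notin> {0, 6, 12, 18} \<Longrightarrow> \<not> 6 dvd k \<and> \<not> 12 dvd k"
    "k mod 24 \<in> {6, 18} \<Longrightarrow> 6 dvd k \<and> \<not> 12 dvd k"
    "k mod 12 = 0 \<Longrightarrow> 6 dvd k \<and> 12 dvd k"
    unfolding insert_iff empty_iff by presburger+
  ultimately show ?thesis
    by (auto simp: missed_invariants_def)
qed

end
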